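(* Let $n\ge 1$ be an integer and let $G$ be any (finite, simple) graph. Let $M_1,\ldots,M_{3n-2}$ be matchings in $G$ (not necessarily distinct), each of size $n$. Then there is a rainbow matching of size $n$ for the family $(M_1,\ldots,M_{3n-2})$; that is, there are $n$ pairwise disjoint edges $e_1,\ldots,e_n$ of $G$ and distinct indices $i_1,\ldots,i_n\in\{1,\ldots,3n-2\}$ with $e_j\in M_{i_j}$ for every $j$.
   Context: Given a system $(C_1,\ldots,C_m)$ of sets of edges in a graph, a rainbow matching for it is a matching each of whose edges is chosen from a different $C_i$ (not all $C_i$ need be represented). *)

theory Defs
  imports Main
begin

definition simple_graph :: "'a set \<Rightarrow> 'a set set \<Rightarrow> bool" where
  "simple_graph V E \<longleftrightarrow> finite V \<and> (\<forall>e\<in>E. e \<subseteq> V \<and> card e = 2)"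

definition matching :: "'a set set \<Rightarrow> 'a set set \<Rightarrow> bool" where
  "matching E M \<longleftrightarrow> M \<subseteq> E \<and> pairwise disjnt M"

text \<open>
  The system is a family \<open>C\<close> of edge sets indexed by \<open>I\<close>, so the same set may occur under several
  indices. The witness \<open>c\<close> assigns to each edge of \<open>R\<close> the index of the set it is chosen from.
\<close>

definition rainbow_matching ::
    "'a set set \<Rightarrow> 'i set \<Rightarrow> ('i \<Rightarrow> 'a set set) \<Rightarrow> 'a set set \<Rightarrow> bool" where
  "rainbow_matching E I C R \<longleftrightarrow>
     matching E R \<and> (\<exists>c. inj_on c R \<and> (\<forall>e\<in>R. c e \<in> I \<and> e \<in> C (c e)))"

end

theory Submission
  imports Defs
begin

text \<open>
  Let \<open>R\<close> be a rainbow matching of size \<open>k < n\<close>, and suppose that none of size \<open>k + 1\<close> exists. Enlarge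
  \<open>R\<close> to a set \<open>K\<close> of edges by adding, one at a time, edges from distinct unused matchings. As all
  matchings inside \<open>K\<close> are rainbow, \<open>K\<close> keeps matching number \<open>k\<close>. Let \<open>D K\<close> be the set of vertices
  missed by some maximum matching of \<open>K\<close>; it contains all vertices outside \<open>R\<close>, so it can grow at most
  \<open>2 k\<close> times. Call an edge harmless if adding it changes neither the matching number nor \<open>D K\<close>. A
  matching of harmless edges has size at most \<open>k\<close>, so each unused matching provides an edge that
  makes \<open>D K\<close> grow, a contradiction after \<open>2 k + 1\<close> steps; these need \<open>k + 2 k + 1 \<le> 3 n - 2\<close> matchings.

  The bound on matchings of harmless edges follows Gallai and Edmonds: vertices outside \<open>D K\<close> that are
  adjacent to \<open>D K\<close> can be deleted one by one. Once there are none left, every edge in question lies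
  outside \<open>D K\<close> or inside a class of the equivalence relation ``no maximum matching misses both''
  on \<open>D K\<close>, and all classes are odd.
\<close>

section \<open>Matchings and missable vertices\<close>

definition edge_set :: "'a set set \<Rightarrow> bool" where
  "edge_set E \<longleftrightarrow> finite E \<and> (\<forall>e\<in>E. card e = 2)"

definition matching_number :: "'a set set \<Rightarrow> nat" where
  "matching_number E = Max (card ` {L. matching E L})"

text \<open>There is no ambient vertex set: for finite \<open>E\<close>, every element of the type
  that lies on no edge of \<open>E\<close> is missable. Growth of this set is therefore measured
  only inside the finite vertex set of a fixed matching.\<close>

definition missable :: "'a set set \<Rightarrow> 'a set" where
  "missable E = {w. \<exists>L. matching E L \<and> card L = matching_number E \<and> w \<notin> \<Union>L}"

definition harmless :: "'a set set \<Rightarrow> 'a set \<Rightarrow> bool" where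
  "harmless E e \<longleftrightarrow> matching_number (insert e E) = matching_number E \<and> missable (insert e E) = missable E"

lemma finite_matchings: "finite E \<Longrightarrow> finite {L. matching E L}"
  by (rule finite_subset[of _ "Pow E"]) (auto simp: matching_def)

lemma matching_empty: "matching E {}"
  by (simp add: matching_def)

lemma matching_subset: "matching E L \<Longrightarrow> L' \<subseteq> L \<Longrightarrow> matching E L'"
  unfolding matching_def by (meson pairwise_mono subset_trans)

lemma matching_mono: "matching E L \<Longrightarrow> E \<subseteq> E' \<Longrightarrow> matching E' L"
  unfolding matching_def by blast

lemma matching_restrict: "matching E L \<Longrightarrow> L \<subseteq> E' \<Longrightarrow> matching E' L"
  unfolding matching_def by blast

lemma matching_finite: "edge_set E \<Longrightarrow> matching E L \<Longrightarrow> finite L"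
  unfolding edge_set_def matching_def by (blast intro: finite_subset)

lemma edge_finite: "edge_set E \<Longrightarrow> e \<in> E \<Longrightarrow> finite e"
  unfolding edge_set_def by (metis card.infinite zero_neq_numeral)

lemma card_le_matching_number: "finite E \<Longrightarrow> matching E L \<Longrightarrow> card L \<le> matching_number E"
  unfolding matching_number_def by (rule Max_ge) (auto simp: finite_matchings)

lemma ex_max_matching:
  assumes "finite E"
  shows "\<exists>L. matching E L \<and> card L = matching_number E"
proof -
  have "matching_number E \<in> card ` {L. matching E L}"
    unfolding matching_number_def by (rule Max_in) (use assms matching_empty in \<open>auto simp: finite_matchings\<close>)
  then show ?thesis by auto
qed

lemma missableI: "matching E L \<Longrightarrow> card L = matching_number E \<Longrightarrow> w \<notin> \<Union>L \<Longrightarrow> w \<in> missable E"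
  unfolding missable_def by blast

lemma missableE:
  assumes "w \<in> missable E"
  obtains L where "matching E L" "card L = matching_number E" "w \<notin> \<Union>L"
  using assms unfolding missable_def by blast

lemma missable_mono: "E \<subseteq> E' \<Longrightarrow> matching_number E = matching_number E' \<Longrightarrow> missable E \<subseteq> missable E'"
  by (metis missableE missableI matching_mono subsetI)

lemma edgeE:
  assumes "edge_set E" "e \<in> E" "v \<in> e"
  obtains p where "p \<noteq> v" "e = {v, p}"
proof -
  have "card e = 2" using assms unfolding edge_set_def by blast
  then obtain x y where "e = {x, y}" "x \<noteq> y" by (meson card_2_iff)
  then show thesis using that[of x] that[of y] assms(3) by auto
qed

lemma edge_neq: "edge_set E \<Longrightarrow> {u, v} \<in> E \<Longrightarrow> u \<noteq> v"
  unfolding edge_set_def by fastforce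

lemma matching_insert:
  assumes "edge_set E" "matching E L" "{p, q} \<in> E" "p \<notin> \<Union>L" "q \<notin> \<Union>L"
  shows "matching E (insert {p, q} L)" "card (insert {p, q} L) = Suc (card L)"
proof -
  show "matching E (insert {p, q} L)"
    using assms unfolding matching_def by (auto simp: pairwise_insert disjnt_def)
  have "{p, q} \<notin> L" using assms by blast
  then show "card (insert {p, q} L) = Suc (card L)"
    using matching_finite[OF assms(1,2)] by simp
qed

lemma matching_remove:
  assumes "edge_set E" "matching E L" "e \<in> L"
  shows "matching E (L - {e})" "card L = Suc (card (L - {e}))" "\<Union>(L - {e}) = \<Union>L - e"
proof -
  show "matching E (L - {e})" using assms(2) by (rule matching_subset) blast
  show "card L = Suc (card (L - {e}))"
    using assms matching_finite[OF assms(1,2)] by (metis card_Suc_Diff1)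
  show "\<Union>(L - {e}) = \<Union>L - e"
    using assms unfolding matching_def pairwise_def disjnt_def by blast
qed

lemma card_Union_matching:
  assumes "edge_set E" "matching E L"
  shows "card (\<Union>L) = 2 * card L" "finite (\<Union>L)"
proof -
  have "card (\<Union>L) = sum card L"
    using assms edge_finite[OF assms(1)] unfolding matching_def
    by (intro card_Union_disjoint) auto
  also have "\<dots> = (\<Sum>e\<in>L. 2)"
    using assms by (intro sum.cong) (auto simp: edge_set_def matching_def)
  finally show "card (\<Union>L) = 2 * card L" by simp
  show "finite (\<Union>L)"
    using assms matching_finite[OF assms] edge_finite[OF assms(1)] unfolding matching_def by auto
qed

section \<open>Exchange along alternating paths\<close>

text \<open>
  Swapping two matchings along the component of their symmetric difference that starts at \<open>v\<close>;
  \<open>t\<close> is the other end of this alternating path, and the two disjuncts are the cases of even and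
  odd length.
\<close>

definition exchanged ::
    "'a set set \<Rightarrow> 'a set set \<Rightarrow> 'a \<Rightarrow> 'a set set \<Rightarrow> 'a set set \<Rightarrow> 'a \<Rightarrow> bool" where
  "exchanged L R v L' R' t \<longleftrightarrow>
     (card L' = card L \<and> card R' = card R \<and> t \<in> \<Union>R \<and> t \<notin> \<Union>L \<and>
      \<Union>L' = insert t (\<Union>L - {v}) \<and> \<Union>R' = insert v (\<Union>R - {t})) \<or>
     (card L = Suc (card L') \<and> card R' = Suc (card R) \<and> t \<in> \<Union>L \<and> t \<notin> \<Union>R \<and>
      \<Union>L' = \<Union>L - {v, t} \<and> \<Union>R' = \<Union>R \<union> {v, t})"

text \<open>Follow the path from \<open>v\<close> through its edge \<open>{v, p}\<close> in
  \<open>L\<close>. If \<open>R\<close> misses \<open>p\<close>, this edge moves to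
  \<open>R\<close>. Otherwise \<open>R\<close> has an edge \<open>{p, q}\<close>; if
  \<open>L\<close> misses \<open>q\<close>, the two edges trade places. Otherwise take both edges
  away, recurse from \<open>q\<close>, which \<open>L1\<close> still covers and \<open>R1\<close>
  misses, and put them back in swapped roles.\<close>

lemma matching_exchange:
  assumes "edge_set E" "matching E L" "matching E R" "v \<in> \<Union>L" "v \<notin> \<Union>R"
  shows "\<exists>L' R' t. matching E L' \<and> matching E R' \<and> t \<noteq> v \<and> exchanged L R v L' R' t"
  using assms(2-)
proof (induction "card L" arbitrary: L R v rule: less_induct)
  case less
  note LE = \<open>matching E L\<close> and RE = \<open>matching E R\<close>
  obtain e where e: "e \<in> L" "v \<in> e" using less.prems by blast
  then have "e \<in> E" using LE unfolding matching_def by blast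
  then obtain p where p: "p \<noteq> v" "e = {v, p}" using edgeE[OF assms(1)] e(2) by metis
  have vpE: "{v, p} \<in> E" using \<open>e \<in> E\<close> p by simp
  define L1 where "L1 = L - {e}"
  note L1 = matching_remove[OF assms(1) LE e(1), folded L1_def, unfolded p(2)]
  have vpL: "v \<in> \<Union>L" "p \<in> \<Union>L" using e p by blast+
  show ?case
  proof (cases "p \<in> \<Union>R")
    case False
    note ins = matching_insert[OF assms(1) RE vpE less.prems(4) False]
    have "\<Union>(insert {v, p} R) = \<Union>R \<union> {v, p}" by blast
    then have "exchanged L R v L1 (insert {v, p} R) p"
      unfolding exchanged_def using L1 ins vpL False by presburger
    then show ?thesis using L1(1) ins(1) p(1) by blast
  next
    case True
    then obtain f where f: "f \<in> R" "p \<in> f" by blast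
    then have "f \<in> E" using RE unfolding matching_def by blast
    then obtain q where q: "q \<noteq> p" "f = {p, q}" using edgeE[OF assms(1)] f(2) by metis
    have pqE: "{p, q} \<in> E" using \<open>f \<in> E\<close> q by simp
    have qv: "q \<noteq> v" using less.prems(4) f q by blast
    define R1 where "R1 = R - {f}"
    note R1 = matching_remove[OF assms(1) RE f(1), folded R1_def, unfolded q(2)]
    have pqR: "p \<in> \<Union>R" "q \<in> \<Union>R" using f q by blast+
    show ?thesis
    proof (cases "q \<in> \<Union>L")
      case False
      have "p \<notin> \<Union>L1" "q \<notin> \<Union>L1" using L1(3) False by auto
      note insL = matching_insert[OF assms(1) L1(1) pqE this]
      have "v \<notin> \<Union>R1" "p \<notin> \<Union>R1" using R1(3) less.prems(4) by auto
      note insR = matching_insert[OF assms(1) R1(1) vpE this]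
      have "\<Union>(insert {p, q} L1) = insert q (\<Union>L - {v})" using L1(3) vpL p by auto
      moreover have "\<Union>(insert {v, p} R1) = insert v (\<Union>R - {q})" using R1(3) pqR q by auto
      ultimately have "exchanged L R v (insert {p, q} L1) (insert {v, p} R1) q"
        unfolding exchanged_def using insL insR L1(2) R1(2) pqR False by presburger
      then show ?thesis using insL insR qv by blast
    next
      case True
      have "card L1 < card L" using L1(2) by simp
      moreover have "q \<in> \<Union>L1" "q \<notin> \<Union>R1" using L1(3) R1(3) True q qv by auto
      ultimately obtain L' R' t where IH: "matching E L'" "matching E R'" "t \<noteq> q"
        and exch: "exchanged L1 R1 q L' R' t"
        using less.hyps[OF _ L1(1) R1(1)] by blast
      note alt = exch[unfolded exchanged_def]
      \<comment> \<open>Neither \<open>L1\<close> nor \<open>R1\<close> covers \<open>p\<close> or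
        \<open>v\<close>, whereas one of them covers \<open>t\<close>. So the recursive exchange
        leaves room for the two swapped edges.\<close>
      have tp: "t \<noteq> p" "t \<noteq> v"
        using alt L1(3) R1(3) less.prems(4) by (auto simp del: Union_iff)
      have "p \<notin> \<Union>L'" "q \<notin> \<Union>L'"
        using alt L1(3) tp(1) IH(3) by (elim disjE; simp del: Union_iff)+
      note insL = matching_insert[OF assms(1) IH(1) pqE this]
      have "v \<notin> \<Union>R'" "p \<notin> \<Union>R'"
        using alt R1(3) less.prems(4) tp q(1) qv p(1) by (elim disjE; simp del: Union_iff)+
      note insR = matching_insert[OF assms(1) IH(2) vpE this]
      have union: "\<Union>(insert {p, q} L') = {p, q} \<union> \<Union>L'" "\<Union>(insert {v, p} R') = {v, p} \<union> \<Union>R'"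
        by simp_all
      have "exchanged L R v (insert {p, q} L') (insert {v, p} R') t"
        using alt unfolding exchanged_def union L1(3) R1(3) L1(2) R1(2) insL(2) insR(2)
      proof (rule disj_forward)
        assume a: "card L' = card L1 \<and> card R' = card R1 \<and> t \<in> \<Union>R - {p, q} \<and> t \<notin> \<Union>L - {v, p} \<and>
          \<Union>L' = insert t (\<Union>L - {v, p} - {q}) \<and> \<Union>R' = insert q (\<Union>R - {p, q} - {t})"
        have "{p, q} \<union> insert t (\<Union>L - {v, p} - {q}) = insert t (\<Union>L - {v})"
          using vpL True p(1) qv by blast
        moreover have "{v, p} \<union> insert q (\<Union>R - {p, q} - {t}) = insert v (\<Union>R - {t})"
          using pqR tp(1) IH(3) by blast
        ultimately show "Suc (card L') = Suc (card L1) \<and> Suc (card R') = Suc (card R1) \<and>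
          t \<in> \<Union>R \<and> t \<notin> \<Union>L \<and>
          {p, q} \<union> \<Union>L' = insert t (\<Union>L - {v}) \<and> {v, p} \<union> \<Union>R' = insert v (\<Union>R - {t})"
          using a tp by (simp del: Union_iff)
      next
        assume a: "card L1 = Suc (card L') \<and> card R' = Suc (card R1) \<and>
          t \<in> \<Union>L - {v, p} \<and> t \<notin> \<Union>R - {p, q} \<and>
          \<Union>L' = \<Union>L - {v, p} - {q, t} \<and> \<Union>R' = \<Union>R - {p, q} \<union> {q, t}"
        have "{p, q} \<union> (\<Union>L - {v, p} - {q, t}) = \<Union>L - {v, t}"
          using vpL True p(1) qv tp(1) IH(3) by blast
        moreover have "{v, p} \<union> (\<Union>R - {p, q} \<union> {q, t}) = \<Union>R \<union> {v, t}"
          using pqR by blast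
        ultimately show "Suc (card L1) = Suc (Suc (card L')) \<and> Suc (card R') = Suc (Suc (card R1)) \<and>
          t \<in> \<Union>L \<and> t \<notin> \<Union>R \<and>
          {p, q} \<union> \<Union>L' = \<Union>L - {v, t} \<and> {v, p} \<union> \<Union>R' = \<Union>R \<union> {v, t}"
          using a tp IH(3) by (simp del: Union_iff)
      qed
      then show ?thesis using insL insR tp by blast
    qed
  qed
qed

section \<open>Gallai's equivalence relation\<close>

text \<open>Equality is added for reflexivity: the second clause fails for a missable vertex paired
  with itself.\<close>

definition linked :: "'a set set \<Rightarrow> 'a \<Rightarrow> 'a \<Rightarrow> bool" where
  "linked E x y \<longleftrightarrow> x = y \<or> (\<forall>L. matching E L \<and> card L = matching_number E \<longrightarrow> x \<in> \<Union>L \<or> y \<in> \<Union>L)"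

lemma linked_sym: "linked E x y \<Longrightarrow> linked E y x"
  unfolding linked_def by blast

text \<open>Suppose a maximum matching \<open>L\<close> misses \<open>x\<close> and
  \<open>z\<close>, hence covers \<open>y\<close>. Exchanging it from \<open>y\<close> with a
  maximum matching that misses \<open>y\<close> gives a maximum matching missing \<open>y\<close>
  and covering only one new vertex \<open>t\<close>. It misses \<open>x\<close> or \<open>z\<close>
  too, against one of the two links.\<close>

lemma linked_trans:
  assumes E: "edge_set E" and y: "y \<in> missable E" and xy: "linked E x y" and yz: "linked E y z"
  shows "linked E x z"
proof (rule ccontr)
  assume n: "\<not> linked E x z"
  then obtain L where L: "matching E L" "card L = matching_number E" "x \<notin> \<Union>L" "z \<notin> \<Union>L"
    unfolding linked_def by blast
  have ne: "x \<noteq> y" "y \<noteq> z" "x \<noteq> z" using n xy yz unfolding linked_def by blast+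
  have yL: "y \<in> \<Union>L" using L xy ne unfolding linked_def by blast
  obtain R where R: "matching E R" "card R = matching_number E" "y \<notin> \<Union>R" using y by (rule missableE)
  from matching_exchange[OF E L(1) R(1) yL R(3)] obtain L' R' t
    where R': "matching E R'" and L': "matching E L'" and "t \<noteq> y" and
      *: "exchanged L R y L' R' t"
    by blast
  \<comment> \<open>A path of odd length would make \<open>R'\<close> larger than a maximum
    matching.\<close>
  have "card R' \<le> matching_number E"
    using card_le_matching_number E R' unfolding edge_set_def by blast
  then have c: "card L' = matching_number E" and U: "\<Union>L' = insert t (\<Union>L - {y})"
    using * L R unfolding exchanged_def by auto
  have "x \<in> \<Union>L' \<or> y \<in> \<Union>L'" "y \<in> \<Union>L' \<or> z \<in> \<Union>L'"
    using xy yz ne L' c unfolding linked_def by blast+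
  then have "x = t" "z = t" using U L \<open>t \<noteq> y\<close> by auto
  then show False using ne by blast
qed

section \<open>Deleting a vertex covered by all maximum matchings\<close>

definition delete_vertex :: "'a \<Rightarrow> 'a set set \<Rightarrow> 'a set set" where
  "delete_vertex a E = {e \<in> E. a \<notin> e}"

lemma edge_set_delete_vertex: "edge_set E \<Longrightarrow> edge_set (delete_vertex a E)"
  unfolding edge_set_def delete_vertex_def by auto

lemma matching_delete_vertex:
  "matching (delete_vertex a E) L \<longleftrightarrow> matching E L \<and> a \<notin> \<Union>L"
  unfolding matching_def delete_vertex_def by auto

lemma matching_remove_vertex:
  assumes "edge_set E" "matching E L" "a \<in> \<Union>L"
  obtains L' where "matching (delete_vertex a E) L'" "card L = Suc (card L')" "\<Union>L' \<subseteq> \<Union>L"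
proof -
  obtain e where e: "e \<in> L" "a \<in> e" using assms(3) by blast
  note r = matching_remove[OF assms(1,2) e(1)]
  show thesis using that[of "L - {e}"] r e(2) by (simp add: matching_delete_vertex)
qed

lemma matching_number_delete_vertex:
  assumes E: "edge_set E" and a: "a \<notin> missable E"
  shows "matching_number E = Suc (matching_number (delete_vertex a E))"
proof -
  have fin: "finite E" "finite (delete_vertex a E)"
    using E edge_set_delete_vertex[OF E] unfolding edge_set_def by blast+
  obtain L where L: "matching E L" "card L = matching_number E" using ex_max_matching[OF fin(1)] by blast
  have "a \<in> \<Union>L" using missableI[OF L] a by blast
  then obtain L' where "matching (delete_vertex a E) L'" "card L = Suc (card L')"
    using matching_remove_vertex[OF E L(1)] by metis
  then have "matching_number E \<le> Suc (matching_number (delete_vertex a E))" using card_le_matching_number[OF fin(2)] L by fastforce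
  moreover obtain R where R: "matching (delete_vertex a E) R" "card R = matching_number (delete_vertex a E)"
    using ex_max_matching[OF fin(2)] by blast
  have ER: "matching E R" "a \<notin> \<Union>R" using R(1) unfolding matching_delete_vertex by simp_all
  have "card R \<le> matching_number E" "card R \<noteq> matching_number E"
    using card_le_matching_number[OF fin(1) ER(1)] missableI[OF ER(1) _ ER(2)] a by auto
  ultimately show ?thesis using R(2) by simp
qed

text \<open>The stability lemma of the Gallai--Edmonds structure theory.\<close>

lemma missable_delete_vertex:
  assumes E: "edge_set E" and a: "a \<notin> missable E" and d: "d \<in> missable E" and ad: "{a, d} \<in> E"
  shows "missable (delete_vertex a E) = insert a (missable E)"
proof
  let ?E = "delete_vertex a E"
  have fin: "finite E" "finite ?E"
    using E edge_set_delete_vertex[OF E] unfolding edge_set_def by blast+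
  note nu = matching_number_delete_vertex[OF E a]
  have "a \<in> missable ?E"
    using ex_max_matching[OF fin(2)] missableI matching_delete_vertex by metis
  moreover have "w \<in> missable ?E" if "w \<in> missable E" for w
  proof -
    from that obtain L where L: "matching E L" "card L = matching_number E" "w \<notin> \<Union>L" by (rule missableE)
    have "a \<in> \<Union>L" using missableI[OF L(1,2)] a by blast
    then obtain L' where L': "matching ?E L'" "card L = Suc (card L')" "\<Union>L' \<subseteq> \<Union>L"
      using matching_remove_vertex[OF E L(1)] by metis
    show ?thesis by (rule missableI[OF L'(1)]) (use L L' nu in auto)
  qed
  ultimately show "insert a (missable E) \<subseteq> missable ?E" by blast
  \<comment> \<open>Exchange from \<open>w\<close>, with \<open>L\<close> maximum in
    \<open>E\<close> and missing \<open>d\<close>, and \<open>R\<close> one edge smaller and missing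
    \<open>a\<close> and \<open>w\<close>. An even path would leave a maximum matching missing
    \<open>w\<close>; so the path is odd and \<open>R'\<close> is maximum, hence covers
    \<open>a\<close>, which forces \<open>t = a\<close>. Now \<open>L'\<close> misses
    \<open>w\<close>, \<open>a\<close> and \<open>d\<close>, and adding \<open>{a, d}\<close> to it
    makes \<open>w\<close> missable in \<open>E\<close>.\<close>
  show "missable ?E \<subseteq> insert a (missable E)"
  proof (rule subsetI, rule ccontr)
    fix w assume "w \<in> missable ?E" and w: "w \<notin> insert a (missable E)"
    then obtain R where "matching ?E R" and cR: "card R = matching_number ?E" and wR: "w \<notin> \<Union>R"
      by (metis missableE)
    then have R: "matching E R" "a \<notin> \<Union>R" by (simp_all add: matching_delete_vertex)
    obtain L where L: "matching E L" "card L = matching_number E" "d \<notin> \<Union>L" using d by (rule missableE)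
    have wL: "w \<in> \<Union>L" using missableI[OF L(1,2)] w by blast
    from matching_exchange[OF E L(1) R(1) wL wR] obtain L' R' t
      where L': "matching E L'" and R': "matching E R'" and "t \<noteq> w" and
        *: "exchanged L R w L' R' t"
      by blast
    have "w \<notin> \<Union>L'" using * \<open>t \<noteq> w\<close> unfolding exchanged_def by auto
    then have "card L' \<noteq> matching_number E" using missableI[OF L'] w by blast
    then have c: "matching_number E = Suc (card L')" "card R' = matching_number E" "\<Union>L' = \<Union>L - {w, t}"
        "\<Union>R' = \<Union>R \<union> {w, t}"
      using * L(2) cR nu unfolding exchanged_def by auto
    have "a \<in> \<Union>R'" using missableI[OF R' c(2)] a by blast
    then have "t = a" using c(4) R(2) w by auto
    then have "a \<notin> \<Union>L'" "d \<notin> \<Union>L'" using c(3) L(3) by auto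
    note ins = matching_insert[OF E L' ad this]
    have "w \<notin> \<Union>(insert {a, d} L')" using \<open>w \<notin> \<Union>L'\<close> w d by auto
    then show False using missableI[OF ins(1)] ins(2) c(1) w by auto
  qed
qed

section \<open>Matchings of harmless edges\<close>

lemma linked_edge:
  assumes "edge_set E" "{x, y} \<in> E"
  shows "linked E x y"
  using matching_insert[OF assms(1) _ assms(2)] card_le_matching_number assms(1)
  unfolding linked_def edge_set_def by (metis Suc_n_not_le_n)

text \<open>Maximum matchings of \<open>E\<close> remain maximum after a harmless edge is added, and
  there \<open>linked_edge\<close> applies.\<close>

lemma linked_harmless:
  assumes "edge_set E" "harmless E {x, y}" "x \<noteq> y"
  shows "linked E x y"
proof -
  let ?E = "insert {x, y} E"
  have E': "edge_set ?E" using assms unfolding edge_set_def by simp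
  have "linked ?E x y" using linked_edge[OF E'] by blast
  then show ?thesis using assms(2,3) matching_mono[of E _ ?E] unfolding linked_def harmless_def
    by (metis subset_insertI)
qed

text \<open>
  The class of vertices linked to \<open>w\<close> is odd, since a maximum matching missing \<open>w\<close> covers the rest
  of it by edges inside it. Edges of \<open>M\<close> do not leave the class either, so \<open>M\<close> misses one of its
  vertices.
\<close>

lemma harmless_matching_closed:
  assumes E: "edge_set E" and F: "edge_set F" and M: "matching F M"
    and harmless: "\<And>e. e \<in> M \<Longrightarrow> harmless E e"
    and closed: "\<And>a d. {a, d} \<in> E \<Longrightarrow> d \<in> missable E \<Longrightarrow> a \<in> missable E"
  shows "card M \<le> matching_number E"
proof -
  have fin: "finite E" using E unfolding edge_set_def by blast
  obtain L where L: "matching E L" "card L = matching_number E" using ex_max_matching[OF fin] by blast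
  define C where "C w = {x \<in> missable E. linked E x w}" for w
  \<comment> \<open>A common finite ground set: the bound will follow once \<open>M\<close> is seen
    to miss at least as many vertices of \<open>V\<close> as \<open>L\<close> does.\<close>
  define V where "V = \<Union>E \<union> \<Union>M"
  note UL = card_Union_matching[OF E L(1)] and UM = card_Union_matching[OF F M]
  have finV: "finite V" using UM fin edge_finite[OF E] unfolding V_def by auto
  have LV: "\<Union>L \<subseteq> V" using L(1) unfolding matching_def V_def by blast
  have MV: "\<Union>M \<subseteq> V" unfolding V_def by blast
  have E_step: "y \<in> C w" if "x \<in> C w" "{x, y} \<in> E" for x y w
  proof -
    have "y \<in> missable E" using closed that unfolding C_def by (metis (no_types, lifting) insert_commute mem_Collect_eq)
    then show ?thesis
      using that(1) linked_trans[OF E _ linked_sym[OF linked_edge[OF E that(2)]], of w]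
      unfolding C_def by simp
  qed
  have M_step: "y \<in> C w" if x: "x \<in> C w" and xy: "{x, y} \<in> M" for x y w
  proof -
    have ne: "x \<noteq> y" using edge_neq[OF F] xy M unfolding matching_def by blast
    note h = harmless[OF xy]
    \<comment> \<open>Otherwise a maximum matching \<open>R\<close> missing \<open>x\<close>
      contains some \<open>{y, z}\<close>. Trading that edge for \<open>{x, y}\<close> shows that
      \<open>z\<close> is missable in the enlarged graph, hence in \<open>E\<close> by harmlessness,
      and \<open>closed\<close> carries this over to \<open>y\<close>.\<close>
    have "y \<in> missable E"
    proof (rule ccontr)
      assume y: "y \<notin> missable E"
      have "x \<in> missable E" using x unfolding C_def by blast
      then obtain R where R: "matching E R" "card R = matching_number E" "x \<notin> \<Union>R" by (rule missableE)
      have "y \<in> \<Union>R" using missableI[OF R(1,2)] y by blast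
      then obtain e where e: "e \<in> R" "y \<in> e" by blast
      then have "e \<in> E" using R(1) unfolding matching_def by blast
      then obtain z where z: "z \<noteq> y" "e = {y, z}" using edgeE[OF E] e(2) by metis
      note r = matching_remove[OF E R(1) e(1)]
      let ?E = "insert {x, y} E"
      have E': "edge_set ?E" using E ne unfolding edge_set_def by simp
      have R': "matching ?E (R - {e})" using r(1) matching_mono by blast
      have "x \<notin> \<Union>(R - {e})" "y \<notin> \<Union>(R - {e})" using r(3) R(3) e by auto
      note ins = matching_insert[OF E' R' insertI1 this]
      have "z \<notin> \<Union>(insert {x, y} (R - {e}))" using r(3) z e R(3) by auto
      then have "z \<in> missable ?E"
        using missableI[OF ins(1)] ins(2) r(2) R(2) h unfolding harmless_def by simp
      then have "z \<in> missable E" using h unfolding harmless_def by simp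
      then show False using closed[of y z] \<open>e \<in> E\<close> z(2) y by simp
    qed
    moreover have "linked E y w"
      using x linked_trans[OF E _ linked_sym[OF linked_harmless[OF E h ne]], of w]
      unfolding C_def by simp
    ultimately show ?thesis unfolding C_def by blast
  qed
  have ex: "\<exists>x. x \<in> V - \<Union>M \<and> x \<in> C w" if w: "w \<in> V - \<Union>L" for w
  proof (rule ccontr)
    assume n: "\<not> ?thesis"
    have wD: "w \<in> missable E" using w missableI[OF L] by blast
    then have wC: "w \<in> C w" unfolding C_def linked_def by blast
    have CV: "C w \<subseteq> V"
    proof
      fix x assume x: "x \<in> C w"
      have "x \<in> \<Union>L \<or> x = w" using x w L unfolding C_def linked_def by blast
      then show "x \<in> V" using LV w by blast
    qed
    then have finC: "finite (C w)" using finV finite_subset by blast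
    define L0 where "L0 = {e \<in> L. e \<subseteq> C w}"
    have "C w - {w} \<subseteq> \<Union>L0"
    proof
      fix x assume x: "x \<in> C w - {w}"
      then have "x \<in> \<Union>L" using w L unfolding C_def linked_def by blast
      then obtain e where e: "e \<in> L" "x \<in> e" by blast
      then have "e \<in> E" using L(1) unfolding matching_def by blast
      then obtain y where "e = {x, y}" using edgeE[OF E] e(2) by metis
      then have "e \<subseteq> C w" using E_step[of x w y] x \<open>e \<in> E\<close> by simp
      then show "x \<in> \<Union>L0" using e unfolding L0_def by blast
    qed
    then have "C w - {w} = \<Union>L0" using w unfolding L0_def by blast
    moreover have "matching E L0" using L(1) by (rule matching_subset) (auto simp: L0_def)
    ultimately have "card (C w - {w}) = 2 * card L0" using card_Union_matching[OF E] by metis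
    then have odd: "card (C w) = Suc (2 * card L0)" using wC finC by (metis card_Suc_Diff1)
    define M0 where "M0 = {e \<in> M. e \<subseteq> C w}"
    have "C w \<subseteq> \<Union>M0"
    proof
      fix x assume x: "x \<in> C w"
      then have "x \<in> \<Union>M" using n CV by blast
      then obtain e where e: "e \<in> M" "x \<in> e" by blast
      then have "e \<in> F" using M unfolding matching_def by blast
      then obtain y where "e = {x, y}" using edgeE[OF F] e(2) by metis
      then have "e \<subseteq> C w" using M_step[of x w y] x e by simp
      then show "x \<in> \<Union>M0" using e unfolding M0_def by blast
    qed
    then have "C w = \<Union>M0" unfolding M0_def by blast
    moreover have "matching F M0" using M by (rule matching_subset) (auto simp: M0_def)
    ultimately have "card (C w) = 2 * card M0" using card_Union_matching[OF F] by metis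
    then show False using odd by presburger
  qed
  then obtain g where g: "\<And>w. w \<in> V - \<Union>L \<Longrightarrow> g w \<in> V - \<Union>M \<and> g w \<in> C w" by metis
  \<comment> \<open>Vertices with a common image are linked to each other; as \<open>L\<close>
    misses both, they are equal.\<close>
  have "inj_on g (V - \<Union>L)"
  proof (rule inj_onI)
    fix w w' assume w: "w \<in> V - \<Union>L" "w' \<in> V - \<Union>L" "g w = g w'"
    then have "g w \<in> C w" "g w \<in> C w'" using g by metis+
    then have "linked E w w'" using linked_trans[OF E, of "g w" w w'] linked_sym[of E "g w" w]
      unfolding C_def by simp
    then show "w = w'" using w L unfolding linked_def by blast
  qed
  then have "card (V - \<Union>L) \<le> card (V - \<Union>M)"
    using g finV by (intro card_inj_on_le[of g]) auto
  then have "card V - card (\<Union>L) \<le> card V - card (\<Union>M)"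
    using UL(2) UM(2) LV MV by (simp add: card_Diff_subset)
  moreover have "card (\<Union>M) \<le> card V" "card (\<Union>L) \<le> card V" using finV LV MV card_mono by blast+
  ultimately show ?thesis using UL(1) UM(1) L(2) by simp
qed

text \<open>The stability lemma applies at \<open>a\<close> both before and after adding
  \<open>e\<close>, since the missable sets agree, and it changes both graphs in the same
  way.\<close>

lemma harmless_delete_vertex:
  assumes E: "edge_set E" and a: "a \<notin> missable E" and d: "d \<in> missable E" and ad: "{a, d} \<in> E"
    and h: "harmless E e" and e: "card e = 2" "a \<notin> e"
  shows "harmless (delete_vertex a E) e"
proof -
  let ?E = "insert e E"
  have E': "edge_set ?E" using E e unfolding edge_set_def by simp
  have m: "missable ?E = missable E" "matching_number ?E = matching_number E" using h unfolding harmless_def by simp_all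
  have "delete_vertex a ?E = insert e (delete_vertex a E)"
    using e unfolding delete_vertex_def by auto
  then show ?thesis
    using matching_number_delete_vertex[OF E a] matching_number_delete_vertex[OF E', unfolded m, OF a]
      missable_delete_vertex[OF E a d ad] missable_delete_vertex[OF E', unfolded m, OF a d] ad
    unfolding harmless_def by simp
qed

text \<open>Deleting \<open>a\<close> lowers the matching number by exactly one and costs
  \<open>M\<close> at most one edge, so induction on the size of \<open>E\<close> reduces to the
  closed case. The set \<open>F\<close> is separate because edges of \<open>M\<close> need not lie
  in \<open>E\<close>.\<close>

lemma harmless_matching:
  assumes "edge_set E" "edge_set F" "matching F M" "\<And>e. e \<in> M \<Longrightarrow> harmless E e"
  shows "card M \<le> matching_number E"
  using assms
proof (induction "card E" arbitrary: E M rule: less_induct)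
  case less
  note E = less.prems(1) and F = less.prems(2) and M = less.prems(3)
  show ?case
  proof (cases "\<exists>a d. {a, d} \<in> E \<and> d \<in> missable E \<and> a \<notin> missable E")
    case False
    show ?thesis by (rule harmless_matching_closed[OF E F M less.prems(4)]) (use False in auto)
  next
    case True
    then obtain a d where ad: "{a, d} \<in> E" and d: "d \<in> missable E" and a: "a \<notin> missable E" by blast
    let ?E = "delete_vertex a E"
    have "?E \<subset> E" using ad unfolding delete_vertex_def by blast
    then have lt: "card ?E < card E" using E unfolding edge_set_def by (simp add: psubset_card_mono)
    obtain M' where M': "M' \<subseteq> M" "a \<notin> \<Union>M'" "card M \<le> Suc (card M')"
    proof (cases "a \<in> \<Union>M")
      case True
      then obtain e where e: "e \<in> M" "a \<in> e" by blast
      note r = matching_remove[OF F M e(1)]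
      have "a \<notin> \<Union>(M - {e})" using r(3) e(2) by simp
      then show ?thesis using that[of "M - {e}"] r(2) by auto
    next
      case False
      then show ?thesis using that[of M] by simp
    qed
    have "harmless ?E e" if "e \<in> M'" for e
    proof (rule harmless_delete_vertex[OF E a d ad])
      show "harmless E e" using that M' less.prems(4) by blast
      show "card e = 2" using that M' M F unfolding edge_set_def matching_def by blast
      show "a \<notin> e" using that M' by blast
    qed
    then have "card M' \<le> matching_number ?E"
      using less.hyps[OF lt edge_set_delete_vertex[OF E] F matching_subset[OF M M'(1)]] by blast
    then show ?thesis using M'(3) matching_number_delete_vertex[OF E a] by simp
  qed
qed

section \<open>Enlarging a rainbow matching\<close>

text \<open>This is the witness in \<open>rainbow_matching\<close>, now for edge sets that need not
  be matchings; every matching inside \<open>K\<close> inherits it.\<close>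

definition colouring :: "'i set \<Rightarrow> ('i \<Rightarrow> 'a set set) \<Rightarrow> 'a set set \<Rightarrow> ('a set \<Rightarrow> 'i) \<Rightarrow> bool" where
  "colouring I C K c \<longleftrightarrow> inj_on c K \<and> (\<forall>e\<in>K. c e \<in> I \<and> e \<in> C (c e))"

lemma colouring_insert:
  assumes "colouring I C K c" "e \<notin> K" "i \<in> I" "i \<notin> c ` K" "e \<in> C i"
  shows "colouring I C (insert e K) (c(e := i))"
  using assms unfolding colouring_def inj_on_def by auto

lemma rainbow_matching_subset:
  assumes "colouring I C K c" "K \<subseteq> E" "matching K R"
  shows "rainbow_matching E I C R"
  unfolding rainbow_matching_def
proof (intro conjI exI[of _ c])
  show "matching E R" using assms matching_mono by blast
  show "inj_on c R" using assms unfolding colouring_def matching_def by (meson inj_on_subset)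
  show "\<forall>e\<in>R. c e \<in> I \<and> e \<in> C (c e)" using assms unfolding colouring_def matching_def by blast
qed

lemma rainbow_matching_extend:
  assumes E: "edge_set E" and I: "finite I" "3 * k < card I"
    and C: "\<And>i. i \<in> I \<Longrightarrow> matching E (C i) \<and> k < card (C i)"
    and R: "rainbow_matching E I C R" "card R = k"
  shows "\<exists>R'. rainbow_matching E I C R' \<and> card R' = Suc k"
proof (rule ccontr)
  assume none: "\<not> ?thesis"
  have ER: "matching E R" using R unfolding rainbow_matching_def by blast
  \<comment> \<open>A larger matching inside \<open>K\<close> would be rainbow and could be trimmed
    to \<open>k + 1\<close> edges.\<close>
  have small: "matching_number K = k" if K: "colouring I C K c" "K \<subseteq> E" "R \<subseteq> K" for K c
  proof -
    have fin: "finite K" using K(2) E finite_subset unfolding edge_set_def by blast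
    have "matching K R" using matching_restrict[OF ER K(3)] .
    then have "k \<le> matching_number K" using card_le_matching_number[OF fin] R(2) by blast
    moreover have False if le: "Suc k \<le> matching_number K"
    proof -
      obtain L where L: "matching K L" "card L = matching_number K" using ex_max_matching[OF fin] by blast
      obtain L' where L': "L' \<subseteq> L" "card L' = Suc k"
        using le unfolding L(2)[symmetric] by (rule obtain_subset_with_card_n)
      have "rainbow_matching E I C L'"
        by (rule rainbow_matching_subset[OF K(1,2) matching_subset[OF L(1) L'(1)]])
      then show False using none L'(2) by simp
    qed
    ultimately show ?thesis by force
  qed
  note UR = card_Union_matching[OF E ER]
  have "\<exists>K c. colouring I C K c \<and> K \<subseteq> E \<and> R \<subseteq> K \<and> card K = k + j \<and>
      j \<le> card (missable K \<inter> \<Union>R)" if "j \<le> Suc (2 * k)" for j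
    using that
  proof (induction j)
    case 0
    then show ?case using R unfolding rainbow_matching_def matching_def colouring_def by auto
  next
    case (Suc j)
    then obtain K c where K: "colouring I C K c" "K \<subseteq> E" "R \<subseteq> K" "card K = k + j"
      "j \<le> card (missable K \<inter> \<Union>R)" by auto
    have EK: "edge_set K" using E K(2) finite_subset unfolding edge_set_def by blast
    then have fin: "finite K" unfolding edge_set_def by blast
    \<comment> \<open>Here \<open>j \<le> 2 * k\<close>, so at most \<open>3 * k\<close> indices are
      in use and one is still free.\<close>
    have "card (c ` K) \<le> 3 * k" using card_image_le[OF fin, of c] K(4) Suc.prems by simp
    then have "\<not> I \<subseteq> c ` K" using I(2) fin card_mono[of "c ` K" I] by fastforce
    then obtain i where i: "i \<in> I" "i \<notin> c ` K" by blast
    have "\<not> card (C i) \<le> matching_number K" using small[OF K(1-3)] C[OF i(1)] by simp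
    then obtain e where e: "e \<in> C i" "\<not> harmless K e"
      using harmless_matching[OF EK E] C[OF i(1)] by blast
    have eK: "e \<notin> K" using e(2) unfolding harmless_def by (auto simp: insert_absorb)
    have eE: "e \<in> E" using C[OF i(1)] e(1) unfolding matching_def by blast
    let ?K = "insert e K"
    have c': "colouring I C ?K (c(e := i))" using colouring_insert[OF K(1) eK i e(1)] .
    have K': "?K \<subseteq> E" "R \<subseteq> ?K" using K eE by auto
    have nu: "matching_number K = k" "matching_number ?K = k"
      using small[OF K(1-3)] small[OF c' K'] by simp_all
    have sub: "missable K \<subseteq> missable ?K" using missable_mono[of K ?K] nu by auto
    then obtain x where x: "x \<in> missable ?K" "x \<notin> missable K"
      using e(2) nu unfolding harmless_def by auto
    \<comment> \<open>\<open>R\<close> is itself a maximum matching of \<open>K\<close>, so all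
      vertices outside it were missable already.\<close>
    have "x \<in> \<Union>R" using missableI[OF matching_restrict[OF ER K(3)]] R(2) nu x(2) by auto
    then have "missable K \<inter> \<Union>R \<subset> missable ?K \<inter> \<Union>R" using x sub by blast
    then have "card (missable K \<inter> \<Union>R) < card (missable ?K \<inter> \<Union>R)"
      using UR(2) by (intro psubset_card_mono) auto
    then show ?case using c' K' K(4,5) eK fin
      by (intro exI[of _ ?K] exI[of _ "c(e := i)"]) (auto simp del: fun_upd_apply)
  qed
  from this[of "Suc (2 * k)"] obtain K where "Suc (2 * k) \<le> card (missable K \<inter> \<Union>R)" by blast
  also have "\<dots> \<le> card (\<Union>R)" using UR(2) by (intro card_mono) auto
  finally show False using UR(1) R(2) by simp
qed

theorem theorem1p9:
  fixes V :: "'a set" and E :: "'a set set" and M :: "nat \<Rightarrow> 'a set set" and n :: nat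
  assumes "n \<ge> 1"
    and "simple_graph V E"
    and "\<And>i. i \<in> {1..3 * n - 2} \<Longrightarrow> matching E (M i) \<and> card (M i) = n"
  shows "\<exists>R. rainbow_matching E {1..3 * n - 2} M R \<and> card R = n"
proof -
  have "finite E"
    by (rule finite_subset[of _ "Pow V"]) (use assms(2) in \<open>auto simp: simple_graph_def\<close>)
  then have E: "edge_set E" using assms(2) unfolding edge_set_def simple_graph_def by blast
  have "\<exists>R. rainbow_matching E {1..3 * n - 2} M R \<and> card R = k" if "k \<le> n" for k
    using that
  proof (induction k)
    case 0
    show ?case by (rule exI[of _ "{}"]) (simp add: rainbow_matching_def matching_empty)
  next
    case (Suc k)
    then obtain R where "rainbow_matching E {1..3 * n - 2} M R" "card R = k" by auto
    \<comment> \<open>From \<open>k \<le> n - 1\<close> comes \<open>3 * k \<le> 3 * n - 3\<close>,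
      one less than the number of indices.\<close>
    moreover have "3 * k < card {1..3 * n - 2}" "k < n" using Suc.prems by auto
    ultimately show ?case using rainbow_matching_extend[OF E] assms(3) by (metis finite_atLeastAtMost)
  qed
  then show ?thesis by blast
qed

end
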